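(* Let $G$ be a torsion group and let $n\in \pi_e(G)$ be such that $\Omega(n)$ is maximum among all elements of $\pi_e(G)$. Then: (1) $\mathcal{RP}^*(G)$ is $\Omega(n)$-partite; (2) $\omega(\mathcal{RP}^*(G))=\Omega(n)=\chi(\mathcal{RP}^*(G))$; and so $\mathcal{RP}^*(G)$ is weakly $\chi$-perfect.
   Context: For a group $G$ with identity $e$, the reduced power graph $\mathcal{RP}(G)$ is the simple graph with vertex set $G$ in which $u,v$ are adjacent if and only if $\langle v\rangle\subset\langle u\rangle$ or $\langle u\rangle\subset\langle v\rangle$, where $\subset$ means proper inclusion. The proper reduced power graph $\mathcal{RP}^*(G)$ is the subgraph of $\mathcal{RP}(G)$ induced on $G\setminus\{e\}$. $\pi_e(G)$ denotes the set of orders of elements of $G$. $\Omega(n)$ is the number of prime factors of $n$ counted with multiplicity. $\omega$ denotes the clique number and $\chi$ the chromatic number of a graph. A graph $\Gamma$ is weakly $\chi$-perfect if $\omega(\Gamma)=\chi(\Gamma)$. *)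

theory Defs
  imports
    "HOL-Algebra.Multiplicative_Group"
    "HOL-Computational_Algebra.Primes"
    "HOL-Library.Extended_Nat"
    "HOL-Library.Disjoint_Sets"
begin

section \<open>Simple graphs, possibly infinite\<close>

record 'a sgraph =
  vertices :: "'a set"
  edges :: "'a set set"

definition simple_graph :: "'a sgraph \<Rightarrow> bool" where
  "simple_graph \<Gamma> \<longleftrightarrow> (\<forall>e \<in> edges \<Gamma>. e \<subseteq> vertices \<Gamma> \<and> card e = 2)"

definition induced_subgraph :: "'a sgraph \<Rightarrow> 'a set \<Rightarrow> 'a sgraph" where
  "induced_subgraph \<Gamma> S =
     \<lparr>vertices = vertices \<Gamma> \<inter> S, edges = {e \<in> edges \<Gamma>. e \<subseteq> S}\<rparr>"

definition clique :: "'a sgraph \<Rightarrow> 'a set \<Rightarrow> bool" where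
  "clique \<Gamma> C \<longleftrightarrow> C \<subseteq> vertices \<Gamma> \<and> (\<forall>u\<in>C. \<forall>v\<in>C. u \<noteq> v \<longrightarrow> {u, v} \<in> edges \<Gamma>)"

definition independent :: "'a sgraph \<Rightarrow> 'a set \<Rightarrow> bool" where
  "independent \<Gamma> A \<longleftrightarrow> A \<subseteq> vertices \<Gamma> \<and> (\<forall>u\<in>A. \<forall>v\<in>A. {u, v} \<notin> edges \<Gamma>)"

text \<open>
  The clique number is \<open>\<infinity>\<close> if there are cliques of unbounded size. Restricting to
  finite cliques loses nothing, as an infinite clique contains finite cliques of every size.
\<close>

definition clique_number :: "'a sgraph \<Rightarrow> enat" where
  "clique_number \<Gamma> = Sup {enat (card C) | C. clique \<Gamma> C \<and> finite C}"

definition proper_colouring :: "'a sgraph \<Rightarrow> nat \<Rightarrow> ('a \<Rightarrow> nat) \<Rightarrow> bool" where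
  "proper_colouring \<Gamma> k c \<longleftrightarrow>
     (\<forall>v\<in>vertices \<Gamma>. c v < k) \<and> (\<forall>u v. {u, v} \<in> edges \<Gamma> \<longrightarrow> c u \<noteq> c v)"

text \<open>\<open>Inf {} = \<infinity>\<close> on \<^typ>\<open>enat\<close>: the chromatic number is \<open>\<infinity>\<close> if no finite colouring exists.\<close>

definition chromatic_number :: "'a sgraph \<Rightarrow> enat" where
  "chromatic_number \<Gamma> = Inf {enat k | k. \<exists>c. proper_colouring \<Gamma> k c}"

definition weakly_chi_perfect :: "'a sgraph \<Rightarrow> bool" where
  "weakly_chi_perfect \<Gamma> \<longleftrightarrow> clique_number \<Gamma> = chromatic_number \<Gamma>"

text \<open>The \<open>k\<close> classes of the partition are required to be nonempty (by \<^const>\<open>partition_on\<close>).\<close>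

definition k_partite :: "nat \<Rightarrow> 'a sgraph \<Rightarrow> bool" where
  "k_partite k \<Gamma> \<longleftrightarrow>
     (\<exists>P. partition_on (vertices \<Gamma>) P \<and> finite P \<and> card P = k \<and> (\<forall>A\<in>P. independent \<Gamma> A))"


section \<open>Reduced power graphs of groups\<close>

definition torsion_group :: "('a, 'b) monoid_scheme \<Rightarrow> bool" where
  "torsion_group G \<longleftrightarrow>
     group G \<and> (\<forall>x\<in>carrier G. \<exists>k::nat. k > 0 \<and> x [^]\<^bsub>G\<^esub> k = \<one>\<^bsub>G\<^esub>)"

text \<open>
  For elements of infinite order \<^const>\<open>group.ord\<close> is \<open>0\<close>; the set below is thus only
  meaningful as the set of element orders for torsion groups.
\<close>

definition element_orders :: "('a, 'b) monoid_scheme \<Rightarrow> nat set" where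
  "element_orders G = group.ord G ` carrier G"

definition big_omega :: "nat \<Rightarrow> nat" where
  "big_omega n = size (prime_factorization n)"

definition reduced_power_graph :: "('a, 'b) monoid_scheme \<Rightarrow> 'a sgraph" where
  "reduced_power_graph G =
     \<lparr>vertices = carrier G,
      edges = {{u, v} | u v. u \<in> carrier G \<and> v \<in> carrier G \<and>
                 (generate G {v} \<subset> generate G {u} \<or> generate G {u} \<subset> generate G {v})}\<rparr>"

definition proper_reduced_power_graph :: "('a, 'b) monoid_scheme \<Rightarrow> 'a sgraph" where
  "proper_reduced_power_graph G =
     induced_subgraph (reduced_power_graph G) (carrier G - {\<one>\<^bsub>G\<^esub>})"

lemma simple_graph_reduced_power_graph: "simple_graph (reduced_power_graph G)"
  by (auto simp: simple_graph_def reduced_power_graph_def card_2_iff)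

lemma simple_graph_proper_reduced_power_graph: "simple_graph (proper_reduced_power_graph G)"
  using simple_graph_reduced_power_graph[of G]
  by (auto simp: simple_graph_def proper_reduced_power_graph_def induced_subgraph_def)

end

theory Submission
  imports Defs
begin

text \<open>
  Write \<open>\<Omega>\<close> for \<^const>\<open>big_omega\<close>, and let \<open>k = \<Omega>(n)\<close>. A proper inclusion
  \<open>\<langle>v\<rangle> \<subset> \<langle>u\<rangle>\<close> of finite cyclic groups makes the order of \<open>v\<close> a proper divisor of the order
  of \<open>u\<close>, so \<open>\<Omega>\<close> of the order strictly increases along the inclusion
  (\<open>big_omega_ord_less\<close>). As \<open>\<Omega>\<close> of the order lies between \<open>1\<close> and \<open>k\<close> for
  nonidentity elements, \<open>v \<mapsto> \<Omega>(ord v) - 1\<close> is a proper colouring with \<open>k\<close> colours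
  (\<open>proper_colouring_big_omega\<close>). Conversely, start from an element of order \<open>n\<close> and, as long as
  the current element is not the identity, pass to its \<open>p\<close>-th power for some prime \<open>p\<close> dividing
  its order. The nonidentity elements met on the way generate a strictly descending chain of
  cyclic groups, hence form a clique, and there are \<open>k\<close> of them (\<open>exists_clique_below\<close>).

  A proper colouring with \<open>k\<close> colours together with a clique of size \<open>k\<close> forces the clique
  number and the chromatic number to be \<open>k\<close>. The clique also meets every colour class, so that
  the colour classes are nonempty and form a partition into exactly \<open>k\<close> independent sets.
\<close>

section \<open>Graphs with a clique as large as the number of colours\<close>

lemma card_clique_le_colours:
  assumes "proper_colouring \<Gamma> k c" "clique \<Gamma> C"
  shows "inj_on c C" "c ` C \<subseteq> {..<k}" "card C \<le> k"
proof -
  show inj: "inj_on c C"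
    using assms unfolding inj_on_def proper_colouring_def clique_def by blast
  show sub: "c ` C \<subseteq> {..<k}"
    using assms unfolding proper_colouring_def clique_def by auto
  show "card C \<le> k"
    using card_inj_on_le[OF inj sub] by simp
qed

lemma clique_number_eqI:
  assumes col: "proper_colouring \<Gamma> k c"
    and cl: "clique \<Gamma> C" "finite C" "card C = k"
  shows "clique_number \<Gamma> = enat k"
  unfolding clique_number_def
proof (rule antisym)
  show "Sup {enat (card C) | C. clique \<Gamma> C \<and> finite C} \<le> enat k"
    using card_clique_le_colours(3)[OF col] by (auto intro!: Sup_least)
  show "enat k \<le> Sup {enat (card C) | C. clique \<Gamma> C \<and> finite C}"
    using cl by (auto intro!: Sup_upper)
qed

lemma chromatic_number_eqI:
  assumes col: "proper_colouring \<Gamma> k c"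
    and cl: "clique \<Gamma> C" "card C = k"
  shows "chromatic_number \<Gamma> = enat k"
  unfolding chromatic_number_def
proof (rule antisym)
  show "Inf {enat k | k. \<exists>c. proper_colouring \<Gamma> k c} \<le> enat k"
    using col by (auto intro!: Inf_lower)
  show "enat k \<le> Inf {enat k | k. \<exists>c. proper_colouring \<Gamma> k c}"
    using card_clique_le_colours(3)[OF _ cl(1)] cl(2) by (auto intro!: Inf_greatest)
qed

lemma k_partiteI:
  assumes col: "proper_colouring \<Gamma> k c"
    and cl: "clique \<Gamma> C" "card C = k"
  shows "k_partite k \<Gamma>"
proof -
  define cls where "cls i = {v \<in> vertices \<Gamma>. c v = i}" for i
  \<comment> \<open>Counting: the \<open>k\<close> members of the clique have distinct colours, so every colour occurs.\<close>
  have img: "c ` C = {..<k}"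
  proof (rule card_subset_eq)
    show "c ` C \<subseteq> {..<k}"
      by (rule card_clique_le_colours(2)[OF col cl(1)])
    show "card (c ` C) = card {..<k}"
      using card_image[OF card_clique_le_colours(1)[OF col cl(1)]] cl(2) by simp
  qed simp
  have ne: "cls i \<noteq> {}" if "i < k" for i
  proof -
    from that have "i \<in> c ` C" by (simp add: img)
    then obtain v where "v \<in> C" "c v = i" by blast
    with cl(1) have "v \<in> cls i"
      unfolding cls_def clique_def by auto
    then show ?thesis by blast
  qed
  have inj: "inj_on cls {..<k}"
  proof (rule inj_onI)
    fix i j assume "i \<in> {..<k}" "j \<in> {..<k}" and eq: "cls i = cls j"
    then obtain v where v: "v \<in> cls i" using ne[of i] by auto
    with eq have "v \<in> cls j" by simp
    with v show "i = j" by (simp add: cls_def)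
  qed
  have "partition_on (vertices \<Gamma>) (cls ` {..<k})"
  proof (rule partition_onI)
    show "\<Union> (cls ` {..<k}) = vertices \<Gamma>"
      using col by (auto simp: cls_def proper_colouring_def)
    show "disjnt A B" if "A \<in> cls ` {..<k}" "B \<in> cls ` {..<k}" "A \<noteq> B" for A B
      using that by (auto simp: cls_def disjnt_def)
    show "{} \<notin> cls ` {..<k}"
    proof
      assume "{} \<in> cls ` {..<k}"
      then obtain i where "i < k" "{} = cls i" by (elim imageE) simp
      with ne[of i] show False by simp
    qed
  qed
  moreover have "card (cls ` {..<k}) = k"
    using inj by (simp add: card_image)
  moreover have "independent \<Gamma> (cls i)" for i
    unfolding independent_def
  proof (intro conjI ballI)
    show "cls i \<subseteq> vertices \<Gamma>" by (auto simp: cls_def)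
    show "{u, v} \<notin> edges \<Gamma>" if "u \<in> cls i" "v \<in> cls i" for u v
      using that col by (metis (mono_tags, lifting) cls_def mem_Collect_eq proper_colouring_def)
  qed
  ultimately show ?thesis
    unfolding k_partite_def by (intro exI[of _ "cls ` {..<k}"]) auto
qed

section \<open>The number of prime factors\<close>

lemma big_omega_prime_mult:
  assumes "prime p" "m > 0"
  shows "big_omega (p * m) = Suc (big_omega m)"
  using assms by (simp add: big_omega_def prime_factorization_times_prime)

lemma big_omega_pos:
  assumes "m > 1"
  shows "big_omega m > 0"
  using assms by (simp add: big_omega_def prime_factorization_empty_iff flip: nonempty_has_size)

lemma big_omega_mono_strict:
  assumes "a dvd b" "a < b"
  shows "big_omega a < big_omega b"
proof -
  obtain d where d: "b = a * d" using assms(1) by blast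
  with assms(2) have "a > 0" "d > 1"
    by (cases "a = 0"; cases d; auto)+
  then have "big_omega b = big_omega a + big_omega d"
    by (simp add: d big_omega_def prime_factorization_mult)
  with big_omega_pos[OF \<open>d > 1\<close>] show ?thesis by simp
qed

section \<open>Cliques and colourings of the proper reduced power graph\<close>

lemma edge_proper_reduced_power_graph_iff:
  "{u, v} \<in> edges (proper_reduced_power_graph G) \<longleftrightarrow>
     u \<in> carrier G - {\<one>\<^bsub>G\<^esub>} \<and> v \<in> carrier G - {\<one>\<^bsub>G\<^esub>} \<and>
     (generate G {v} \<subset> generate G {u} \<or> generate G {u} \<subset> generate G {v})"
  by (auto simp: proper_reduced_power_graph_def reduced_power_graph_def induced_subgraph_def
      doubleton_eq_iff)

lemma vertices_proper_reduced_power_graph: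
  "vertices (proper_reduced_power_graph G) = carrier G - {\<one>\<^bsub>G\<^esub>}"
  by (auto simp: proper_reduced_power_graph_def reduced_power_graph_def induced_subgraph_def)

context group
begin

lemma torsion_group_ord_pos:
  assumes "torsion_group G" and x: "x \<in> carrier G"
  shows "ord x > 0"
proof -
  obtain k :: nat where "k > 0" "x [^] k = \<one>"
    using assms unfolding torsion_group_def by blast
  then show ?thesis using pow_eq_id[OF x, of k] by (cases "ord x = 0") auto
qed

lemma generate_singleton_subset:
  assumes "x \<in> carrier G" "y \<in> generate G {x}"
  shows "generate G {y} \<subseteq> generate G {x}"
  using assms by (intro generate_subgroup_incl generate_is_subgroup) auto

lemma big_omega_ord_less:
  assumes u: "u \<in> carrier G" "ord u > 0" and v: "v \<in> carrier G"
    and less: "generate G {v} \<subset> generate G {u}"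
  shows "big_omega (ord v) < big_omega (ord u)"
proof (rule big_omega_mono_strict)
  have "v \<in> generate G {u}"
    using less generate.incl[of v "{v}" G] by blast
  then obtain k :: nat where "v = u [^] k"
    using generate_pow_nat[OF u(1)] u(2) by auto
  then have "v [^] ord u = \<one>"
    using u(1) by (metis nat_pow_one nat_pow_pow mult.commute pow_ord_eq_1)
  then show "ord v dvd ord u"
    using pow_eq_id[OF v] by simp
  have "finite (generate G {u})"
    using u(2) generate_pow_card[OF u(1)] card_gt_0_iff by metis
  then show "ord v < ord u"
    using less generate_pow_card[OF u(1)] generate_pow_card[OF v] psubset_card_mono by metis
qed

text \<open>
  That the clique lies in \<open>\<langle>x\<rangle>\<close> is what lets the induction proceed: each member of the clique
  found in \<open>\<langle>x [^] p\<rangle>\<close> generates a group properly contained in \<open>\<langle>x\<rangle>\<close>, so \<open>x\<close> can be added.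
\<close>

lemma exists_clique_below:
  assumes "x \<in> carrier G" "ord x > 0"
  shows "\<exists>C. C \<subseteq> generate G {x} \<and> clique (proper_reduced_power_graph G) C \<and>
             finite C \<and> card C = big_omega (ord x)"
  using assms
proof (induction "ord x" arbitrary: x rule: less_induct)
  case less
  show ?case
  proof (cases "ord x = 1")
    case True
    then show ?thesis
      by (intro exI[of _ "{}"]) (auto simp: clique_def big_omega_def)
  next
    case False
    then obtain p where p: "prime p" "p dvd ord x"
      using prime_factor_nat by blast
    define y where "y = x [^] p"
    have y: "y \<in> carrier G" using less.prems by (simp add: y_def)
    have "ord y = ord x div p"
      using ord_pow[of x p] p less.prems by (auto simp: y_def)
    then have ordx: "ord x = p * ord y" using p by simp
    with less.prems have "ord y > 0" by (cases "ord y") auto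
    with ordx p(1) have "ord y < ord x"
      using prime_gt_1_nat[of p] by simp
    from less.hyps[OF this y \<open>ord y > 0\<close>] obtain C where
      C: "C \<subseteq> generate G {y}" "clique (proper_reduced_power_graph G) C"
         "finite C" "card C = big_omega (ord y)"
      by blast
    have "y \<in> generate G {x}"
      using generate_pow_nat[of x] less.prems by (auto simp: y_def)
    then have "generate G {y} \<subseteq> generate G {x}"
      using generate_singleton_subset less.prems by blast
    moreover have "generate G {y} \<noteq> generate G {x}"
      using generate_pow_card[OF y] generate_pow_card[of x] less.prems \<open>ord y < ord x\<close> by auto
    ultimately have yx: "generate G {y} \<subset> generate G {x}" by blast
    then have below: "generate G {z} \<subset> generate G {x}" if "z \<in> C" for z
      using generate_singleton_subset[OF y] C(1) that by blast
    then have "x \<notin> C" by blast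
    have "x \<noteq> \<one>" using False by auto
    have "C \<subseteq> carrier G - {\<one>}"
      using C(2) by (simp add: clique_def vertices_proper_reduced_power_graph)
    then have x_edge: "{x, z} \<in> edges (proper_reduced_power_graph G)" if "z \<in> C" for z
      using that below[OF that] less.prems(1) \<open>x \<noteq> \<one>\<close>
      unfolding edge_proper_reduced_power_graph_iff by blast
    have "{z, x} \<in> edges (proper_reduced_power_graph G)" if "z \<in> C" for z
      using x_edge[OF that] by (simp add: insert_commute)
    with x_edge C(2) less.prems(1) \<open>x \<noteq> \<one>\<close>
    have "clique (proper_reduced_power_graph G) (insert x C)"
      by (simp add: clique_def vertices_proper_reduced_power_graph)
    moreover have "insert x C \<subseteq> generate G {x}"
      using C(1) yx generate.incl[of x "{x}" G] by blast
    moreover have "card (insert x C) = big_omega (ord x)"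
      using C(3,4) \<open>x \<notin> C\<close> \<open>ord y > 0\<close> p(1) by (simp add: ordx big_omega_prime_mult)
    ultimately show ?thesis using C(3) by blast
  qed
qed

text \<open>
  The shift by one makes the colours start at \<open>0\<close>. The subtraction truncates only at the
  identity, which is not a vertex.
\<close>

lemma proper_colouring_big_omega:
  assumes ord_pos: "\<And>x. x \<in> carrier G \<Longrightarrow> ord x > 0"
    and bound: "\<And>x. x \<in> carrier G \<Longrightarrow> big_omega (ord x) \<le> k"
  shows "proper_colouring (proper_reduced_power_graph G) k (\<lambda>v. big_omega (ord v) - 1)"
proof -
  have pos: "big_omega (ord x) > 0" if "x \<in> carrier G - {\<one>}" for x
    using that ord_pos[of x] ord_eq_1[of x] by (intro big_omega_pos) force
  have "big_omega (ord v) - 1 < k" if "v \<in> carrier G - {\<one>}" for v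
    using pos[OF that] bound[of v] that by simp
  moreover have "big_omega (ord u) - 1 \<noteq> big_omega (ord v) - 1"
    if "{u, v} \<in> edges (proper_reduced_power_graph G)" for u v
  proof -
    have uv: "u \<in> carrier G - {\<one>}" "v \<in> carrier G - {\<one>}"
      and cmp: "generate G {v} \<subset> generate G {u} \<or> generate G {u} \<subset> generate G {v}"
      using that by (simp_all only: edge_proper_reduced_power_graph_iff)
    from cmp have "big_omega (ord u) \<noteq> big_omega (ord v)"
    proof (elim disjE)
      assume "generate G {v} \<subset> generate G {u}"
      with big_omega_ord_less[of u v] uv ord_pos show ?thesis by force
    next
      assume "generate G {u} \<subset> generate G {v}"
      with big_omega_ord_less[of v u] uv ord_pos show ?thesis by force
    qed
    with pos[OF uv(1)] pos[OF uv(2)] show ?thesis by simp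
  qed
  ultimately show ?thesis
    unfolding proper_colouring_def vertices_proper_reduced_power_graph by blast
qed

end

section \<open>Clique number and chromatic number\<close>

theorem theorem2p1:
  fixes G :: "('a, 'b) monoid_scheme" and n :: nat
  assumes "torsion_group G"
    and "n \<in> element_orders G"
    and "\<And>m. m \<in> element_orders G \<Longrightarrow> big_omega m \<le> big_omega n"
  shows "k_partite (big_omega n) (proper_reduced_power_graph G)
    \<and> clique_number (proper_reduced_power_graph G) = enat (big_omega n)
    \<and> enat (big_omega n) = chromatic_number (proper_reduced_power_graph G)
    \<and> weakly_chi_perfect (proper_reduced_power_graph G)"
proof -
  interpret group G using assms(1) by (simp add: torsion_group_def)
  have ord_pos: "ord x > 0" if "x \<in> carrier G" for x
    using assms(1) that by (rule torsion_group_ord_pos)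
  have col: "proper_colouring (proper_reduced_power_graph G) (big_omega n)
      (\<lambda>v. big_omega (ord v) - 1)"
  proof (rule proper_colouring_big_omega)
    show "big_omega (ord x) \<le> big_omega n" if "x \<in> carrier G" for x
      using that by (intro assms(3)) (simp add: element_orders_def)
  qed (rule ord_pos)
  obtain x where x: "x \<in> carrier G" "ord x = n"
    using assms(2) unfolding element_orders_def by blast
  obtain C where C: "clique (proper_reduced_power_graph G) C" "finite C" "card C = big_omega n"
    using exists_clique_below[OF x(1) ord_pos[OF x(1)]] x(2) by auto
  show ?thesis
    using k_partiteI[OF col C(1,3)] clique_number_eqI[OF col C] chromatic_number_eqI[OF col C(1,3)]
    by (simp add: weakly_chi_perfect_def)
qed

end
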